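(* Let $(X,d)$ be a nonempty metric space and let $U$ be a subset of $F_{USCG}(X)$. Then $U$ is relatively compact in $(F_{USCG}(X), H_{\rm end})$ if and only if $U(\alpha)$ is relatively compact in $(X,d)$ for each $\alpha\in(0,1]$.
   Context: A fuzzy set in $X$ is a function $u:X\to[0,1]$. For $\alpha\in(0,1]$, $[u]_\alpha=\{x\in X: u(x)\ge\alpha\}$, and $[u]_0=\overline{\{x\in X: u(x)>0\}}$ (closure in $X$). $C(X)$ and $K(X)$ denote the sets of all nonempty closed, respectively nonempty compact, subsets of $X$. $F_{USC}(X)$ is the set of fuzzy sets $u$ in $X$ with $[u]_\alpha\in C(X)\cup\{\emptyset\}$ for all $\alpha\in[0,1]$ (the upper semicontinuous fuzzy sets), and $F_{USCG}(X)=\{u\in F_{USC}(X): [u]_\alpha\in K(X)\cup\{\emptyset\}\text{ for all }\alpha\in(0,1]\}$. $X\times[0,1]$ carries the metric $\overline d((x,\alpha),(y,\beta))=d(x,y)+|\alpha-\beta|$. The endograph of $u$ is ${\rm end}\,u=\{(x,t)\in X\times[0,1]: u(x)\ge t\}$; for $u\in F_{USC}(X)$ it is a nonempty closed set. For nonempty closed $A,B\subseteq X\times[0,1]$, $H(A,B)=\max\{\sup_{a\in A}\inf_{b\in B}\overline d(a,b),\ \sup_{b\in B}\inf_{a\in A}\overline d(a,b)\}$. The endograph metric on $F_{USC}(X)$ and its subsets is $H_{\rm end}(u,v)=H({\rm end}\,u,{\rm end}\,v)$. For a set $U$ of fuzzy sets, $U(\alpha)=\bigcup_{u\in U}[u]_\alpha$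 (an empty union is $\emptyset$). A subset $A$ of a metric space $Z$ is relatively compact in $Z$ if its closure in $Z$ is compact (equivalently every sequence in $A$ has a subsequence converging in $Z$). *)

theory Defs
  imports "HOL-Analysis.Analysis"
begin

definition fuzzy_sets :: "('a \<Rightarrow> real) set" where
  "fuzzy_sets = {u. \<forall>x. u x \<in> {0..1}}"

text \<open>The cut at level 0 is the closure of the support, not the set where \<open>u x \<ge> 0\<close>.\<close>

definition alpha_cut :: "('a::metric_space \<Rightarrow> real) \<Rightarrow> real \<Rightarrow> 'a set" where
  "alpha_cut u \<alpha> = (if \<alpha> = 0 then closure {x. u x > 0} else {x. u x \<ge> \<alpha>})"

definition nonempty_closed_sets :: "'a::metric_space set set" where
  "nonempty_closed_sets = {A. A \<noteq> {} \<and> closed A}"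

definition nonempty_compact_sets :: "'a::metric_space set set" where
  "nonempty_compact_sets = {A. A \<noteq> {} \<and> compact A}"

definition F_USC :: "('a::metric_space \<Rightarrow> real) set" where
  "F_USC = {u \<in> fuzzy_sets. \<forall>\<alpha>\<in>{0..1}. alpha_cut u \<alpha> \<in> nonempty_closed_sets \<union> {{}}}"

definition F_USCG :: "('a::metric_space \<Rightarrow> real) set" where
  "F_USCG = {u \<in> F_USC. \<forall>\<alpha>\<in>{0<..1}. alpha_cut u \<alpha> \<in> nonempty_compact_sets \<union> {{}}}"

text \<open>The sum metric; the library's \<open>dist\<close> on pairs is the Euclidean one.\<close>

definition sum_dist :: "'a::metric_space \<times> real \<Rightarrow> 'a \<times> real \<Rightarrow> real" where
  "sum_dist p q = dist (fst p) (fst q) + \<bar>snd p - snd q\<bar>"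

definition endograph :: "('a \<Rightarrow> real) \<Rightarrow> ('a \<times> real) set" where
  "endograph u = {(x, t). t \<in> {0..1} \<and> u x \<ge> t}"

text \<open>The Hausdorff distance is formed in \<open>ennreal\<close>, where all suprema and infima exist.
  On endographs of fuzzy sets it is at most 1, see \<open>Hausdorff_endograph_le_1\<close>.\<close>

definition Hausdorff :: "('a::metric_space \<times> real) set \<Rightarrow> ('a \<times> real) set \<Rightarrow> ennreal" where
  "Hausdorff A B =
     max (SUP a\<in>A. INF b\<in>B. ennreal (sum_dist a b)) (SUP b\<in>B. INF a\<in>A. ennreal (sum_dist a b))"

definition H_end :: "('a::metric_space \<Rightarrow> real) \<Rightarrow> ('a \<Rightarrow> real) \<Rightarrow> real" where
  "H_end u v = enn2real (Hausdorff (endograph u) (endograph v))"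

definition level_union :: "('a::metric_space \<Rightarrow> real) set \<Rightarrow> real \<Rightarrow> 'a set" where
  "level_union U \<alpha> = (\<Union>u\<in>U. alpha_cut u \<alpha>)"

lemma sum_dist_commute: "sum_dist p q = sum_dist q p"
  by (simp add: sum_dist_def dist_commute abs_minus_commute)

lemma Hausdorff_commute: "Hausdorff A B = Hausdorff B A"
  by (simp add: Hausdorff_def max.commute sum_dist_commute)

lemma excess_endograph_le_1:
  assumes "v \<in> fuzzy_sets"
  shows "(SUP a\<in>endograph u. INF b\<in>endograph v. ennreal (sum_dist a b)) \<le> 1"
proof (rule SUP_least)
  fix a :: "'a \<times> real" assume a: "a \<in> endograph u"
  have "(fst a, 0) \<in> endograph v" using assms by (auto simp: endograph_def fuzzy_sets_def)
  then have "(INF b\<in>endograph v. ennreal (sum_dist a b)) \<le> ennreal (sum_dist a (fst a, 0))"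
    by (rule INF_lower)
  also have "\<dots> \<le> 1" using a by (auto simp: sum_dist_def endograph_def)
  finally show "(INF b\<in>endograph v. ennreal (sum_dist a b)) \<le> 1" .
qed

lemma Hausdorff_endograph_le_1:
  assumes "u \<in> fuzzy_sets" "v \<in> fuzzy_sets"
  shows "Hausdorff (endograph u) (endograph v) \<le> 1"
  using excess_endograph_le_1[OF assms(1), of v] excess_endograph_le_1[OF assms(2), of u]
  by (simp add: Hausdorff_def sum_dist_commute)

lemma INF_ennreal_add_const_set:
  fixes f :: "'b \<Rightarrow> ennreal"
  assumes "I \<noteq> {}"
  shows "(INF i\<in>I. f i + c) = (INF i\<in>I. f i) + c"
  using continuous_at_Inf_mono[of "\<lambda>x. x + c" "f ` I"] assms
  using continuous_add[of "at_right (Inf (f ` I))", of "\<lambda>x. x" "\<lambda>x. c"]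
  by (auto simp: mono_def image_comp)

lemma Hausdorff_triangle_half:
  "(SUP a\<in>A. INF c\<in>C. ennreal (sum_dist a c)) \<le> Hausdorff A B + Hausdorff B C"
proof (rule SUP_least)
  fix a assume a: "a \<in> A"
  have *: "(INF c\<in>C. ennreal (sum_dist a c)) \<le> ennreal (sum_dist a b) + Hausdorff B C"
    if b: "b \<in> B" for b
  proof -
    have "(INF c\<in>C. ennreal (sum_dist a c)) \<le> (INF c\<in>C. ennreal (sum_dist a b) + ennreal (sum_dist b c))"
    proof (rule INF_mono)
      fix c assume "c \<in> C"
      have "sum_dist a c \<le> sum_dist a b + sum_dist b c"
        using dist_triangle[of "fst a" "fst c" "fst b"] by (simp add: sum_dist_def)
      then have "ennreal (sum_dist a c) \<le> ennreal (sum_dist a b) + ennreal (sum_dist b c)"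
        by (subst ennreal_plus[symmetric]) (auto simp: sum_dist_def simp del: ennreal_plus intro!: ennreal_leI)
      with \<open>c \<in> C\<close> show "\<exists>n\<in>C. ennreal (sum_dist a n) \<le> ennreal (sum_dist a b) + ennreal (sum_dist b c)"
        by blast
    qed
    also have "\<dots> = ennreal (sum_dist a b) + (INF c\<in>C. ennreal (sum_dist b c))"
      by (cases "C = {}") (simp_all add: INF_ennreal_add_const_set add.commute[of "ennreal (sum_dist a b)"])
    also have "\<dots> \<le> ennreal (sum_dist a b) + Hausdorff B C"
      unfolding Hausdorff_def using b
      by (intro add_left_mono max.coboundedI1 SUP_upper)
    finally show ?thesis .
  qed
  have "(INF c\<in>C. ennreal (sum_dist a c)) \<le> (INF b\<in>B. ennreal (sum_dist a b) + Hausdorff B C)"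
    by (rule INF_greatest) (rule *)
  also have "\<dots> = (INF b\<in>B. ennreal (sum_dist a b)) + Hausdorff B C"
    by (cases "B = {}") (simp_all add: INF_ennreal_add_const_set)
  also have "\<dots> \<le> Hausdorff A B + Hausdorff B C"
    using a by (intro add_right_mono) (auto simp: Hausdorff_def intro!: max.coboundedI1 SUP_upper)
  finally show "(INF c\<in>C. ennreal (sum_dist a c)) \<le> Hausdorff A B + Hausdorff B C" .
qed

lemma Hausdorff_triangle: "Hausdorff A C \<le> Hausdorff A B + Hausdorff B C"
  using Hausdorff_triangle_half[of A C B] Hausdorff_triangle_half[of C A B]
  by (simp add: Hausdorff_def[of A C] sum_dist_commute Hausdorff_commute[of C] Hausdorff_commute[of B A] add.commute)

lemma H_end_zero_imp_le:
  assumes u: "u \<in> F_USC" and v: "v \<in> F_USC" and z: "H_end u v = 0"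
  shows "u x \<le> v x"
proof (rule ccontr)
  assume "\<not> u x \<le> v x"
  then obtain s where s: "v x < s" "s < u x" by (meson dense not_le)
  have uf: "u \<in> fuzzy_sets" and vf: "v \<in> fuzzy_sets" using u v by (auto simp: F_USC_def)
  have bnd: "0 \<le> v x" "u x \<le> 1" using uf vf by (auto simp: fuzzy_sets_def)
  have s01: "s \<in> {0..1}" "s \<noteq> 0" using s bnd by auto
  have "alpha_cut v s \<in> nonempty_closed_sets \<union> {{}}" using v s01 by (auto simp: F_USC_def)
  then have cl: "closed {y. v y \<ge> s}" using s01(2) by (auto simp: alpha_cut_def nonempty_closed_sets_def)
  have "open (- {y. v y \<ge> s})" using cl by blast
  then obtain e where e: "e > 0" "ball x e \<subseteq> - {y. v y \<ge> s}"
    using s(1) unfolding open_contains_ball by (metis ComplI mem_Collect_eq not_le)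
  have "Hausdorff (endograph u) (endograph v) = 0"
    using z Hausdorff_endograph_le_1[OF uf vf] by (auto simp: H_end_def enn2real_eq_0_iff top_unique)
  then have "(SUP a\<in>endograph u. INF b\<in>endograph v. ennreal (sum_dist a b)) \<le> 0"
    by (metis Hausdorff_def max.cobounded1)
  moreover have "(x, u x) \<in> endograph u" using uf by (auto simp: endograph_def fuzzy_sets_def)
  ultimately have "(INF b\<in>endograph v. ennreal (sum_dist (x, u x) b)) \<le> 0"
    by (meson SUP_upper order_trans)
  moreover have "ennreal (min e (u x - s)) \<le> (INF b\<in>endograph v. ennreal (sum_dist (x, u x) b))"
  proof (rule INF_greatest)
    fix b assume b: "b \<in> endograph v"
    show "ennreal (min e (u x - s)) \<le> ennreal (sum_dist (x, u x) b)"
    proof (rule ennreal_leI, cases "dist x (fst b) < e")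
      case True
      then have "v (fst b) < s" using e(2) by (force simp: subset_eq not_le)
      then have "u x - s \<le> \<bar>u x - snd b\<bar>" using b by (auto simp: endograph_def)
      then show "min e (u x - s) \<le> sum_dist (x, u x) b"
        by (simp add: sum_dist_def min.coboundedI2 add_increasing)
    next
      case False
      then show "min e (u x - s) \<le> sum_dist (x, u x) b"
        by (auto simp: sum_dist_def)
    qed
  qed
  ultimately have "ennreal (min e (u x - s)) \<le> 0" by order
  then show False using e(1) s(2) by (auto simp: ennreal_eq_0_iff)
qed

lemma Metric_space_F_USC: "Metric_space F_USC H_end"
proof
  fix u v w :: "'a \<Rightarrow> real"
  show "0 \<le> H_end u v" by (simp add: H_end_def)
  show comm: "H_end p q = H_end q p" for p q :: "'a \<Rightarrow> real"
    by (simp add: H_end_def Hausdorff_commute)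
  assume u: "u \<in> F_USC" and v: "v \<in> F_USC"
  show "H_end u v = 0 \<longleftrightarrow> u = v"
  proof
    assume "H_end u v = 0"
    then show "u = v"
      using H_end_zero_imp_le[OF u v] H_end_zero_imp_le[OF v u] comm[of u v]
      by (auto intro!: ext antisym)
  next
    have "(SUP a\<in>A. INF b\<in>A. ennreal (sum_dist a b)) \<le> 0" for A :: "('a \<times> real) set"
    proof (rule SUP_least)
      fix a assume "a \<in> A"
      then have "(INF b\<in>A. ennreal (sum_dist a b)) \<le> ennreal (sum_dist a a)" by (rule INF_lower)
      then show "(INF b\<in>A. ennreal (sum_dist a b)) \<le> 0" by (simp add: sum_dist_def)
    qed
    then have "Hausdorff A A = 0" for A :: "('a \<times> real) set"
      by (simp add: Hausdorff_def sum_dist_commute)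
    moreover assume "u = v"
    ultimately show "H_end u v = 0" by (simp add: H_end_def)
  qed
  assume w: "w \<in> F_USC"
  have f: "u \<in> fuzzy_sets" "v \<in> fuzzy_sets" "w \<in> fuzzy_sets" using u v w by (auto simp: F_USC_def)
  have fin: "Hausdorff (endograph u) (endograph v) < top" "Hausdorff (endograph v) (endograph w) < top"
    using Hausdorff_endograph_le_1[OF f(1,2)] Hausdorff_endograph_le_1[OF f(2,3)]
    by (auto simp: order_le_less_trans)
  have "H_end u w \<le> enn2real (Hausdorff (endograph u) (endograph v) + Hausdorff (endograph v) (endograph w))"
    unfolding H_end_def using fin by (intro enn2real_mono Hausdorff_triangle) auto
  also have "\<dots> = H_end u v + H_end v w"
    unfolding H_end_def using fin by (rule enn2real_plus)
  finally show "H_end u w \<le> H_end u v + H_end v w" .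
qed

lemma Metric_space_F_USCG: "Metric_space F_USCG H_end"
  by (rule Metric_space.subspace[OF Metric_space_F_USC]) (auto simp: F_USCG_def)

end

theory Submission
  imports Defs
begin

text \<open>
  Everything is reduced to sequences: in any metric space, a set is relatively compact iff each of
  its sequences has a convergent subsequence
  (\<open>relatively_compact_iff_convergent_subsequences\<close>).

  If \<open>u\<^sub>n\<close> converges to \<open>u\<close> in the endograph metric and \<open>x\<^sub>n\<close> lies in the \<open>\<alpha>\<close>-cut of \<open>u\<^sub>n\<close>,
  then the endograph point \<open>(x\<^sub>n, \<alpha>)\<close> is ever closer to a point of \<open>end u\<close>, whose height is
  eventually at least \<open>\<alpha> / 2\<close>. So \<open>x\<^sub>n\<close> approaches the compact \<open>\<alpha> / 2\<close>-cut of \<open>u\<close>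
  and has a convergent subsequence (\<open>convergent_subsequence_in_level\<close>). This is why
  relative compactness of \<open>U\<close> passes to all its positive level unions.

  Conversely, let all positive level unions of \<open>U\<close> be relatively compact. Up to an error \<open>\<epsilon>\<close> the
  endograph of \<open>u \<in> U\<close> is determined by its part above height \<open>\<epsilon>\<close>, which lies over the totally
  bounded set \<open>U(\<epsilon>)\<close>; rounding that part to a finite grid over an \<open>\<epsilon>\<close>-net shows that \<open>U\<close>
  is totally bounded (\<open>mtotally_bounded_if_level_unions_relatively_compact\<close>). Hence each sequence
  in \<open>U\<close> has a Cauchy subsequence. Neither \<open>X\<close> nor the space of fuzzy sets need be complete, but
  the compact closures of the level unions supply a limit: the upper limit of the sequence, that is,
  the fuzzy set whose endograph gathers the cluster points of the endographs
  (\<open>MCauchy_limitin_upper_limit\<close>).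
\<close>

section \<open>Relative compactness in metric spaces\<close>

context Metric_space
begin

lemma relatively_compact_iff_convergent_subsequences:
  assumes "S \<subseteq> M"
  shows "compactin mtopology (mtopology closure_of S) \<longleftrightarrow>
    (\<forall>\<sigma>::nat \<Rightarrow> 'a. range \<sigma> \<subseteq> S \<longrightarrow>
      (\<exists>l r. strict_mono r \<and> limitin mtopology (\<sigma> \<circ> r) l sequentially))"
    (is "?L \<longleftrightarrow> ?R")
proof
  assume ?L
  then show ?R
    using closure_of_subset[of S mtopology] assms
    unfolding compactin_sequentially topspace_mtopology by (meson order_trans)
next
  assume R: ?R
  show ?L
    unfolding compact_closure_of_eq_Bolzano_Weierstrass
  proof (intro allI impI)
    fix T assume T: "infinite T \<and> T \<subseteq> S \<and> T \<subseteq> M"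
    then obtain \<sigma> :: "nat \<Rightarrow> 'a" where \<sigma>: "inj \<sigma>" "range \<sigma> \<subseteq> T"
      using infinite_countable_subset by blast
    then obtain l r where lr: "strict_mono r" "limitin mtopology (\<sigma> \<circ> r) l sequentially"
      using R T by (meson order_trans)
    have "l \<in> mtopology derived_set_of T"
      unfolding metric_derived_set_of
    proof (intro CollectI conjI allI impI)
      show "l \<in> M" using lr(2) by (simp add: limitin_metric)
      fix e :: real assume "0 < e"
      then obtain N where N: "\<And>n. n \<ge> N \<Longrightarrow> \<sigma> (r n) \<in> M \<and> d (\<sigma> (r n)) l < e"
        using lr(2) by (auto simp: limitin_metric eventually_sequentially)
      \<comment> \<open>The terms are distinct, so one of any two of them differs from \<open>l\<close>.\<close>
      have "r N \<noteq> r (Suc N)" using lr(1) by (simp add: strict_mono_eq)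
      then have "\<sigma> (r N) \<noteq> \<sigma> (r (Suc N))" using \<sigma>(1) by (meson injD)
      then obtain n where "n \<ge> N" "\<sigma> (r n) \<noteq> l" by (metis le_refl le_SucI)
      then show "\<exists>y\<in>T. y \<noteq> l \<and> y \<in> mball l e"
        using N[of n] \<sigma>(2) \<open>l \<in> M\<close> by (intro bexI[of _ "\<sigma> (r n)"]) (auto simp: commute)
    qed
    then show "mtopology derived_set_of T \<noteq> {}" by blast
  qed
qed

text \<open>One representative for each of the finitely many values of \<open>code e\<close> gives an \<open>e\<close>-net inside \<open>S\<close>.\<close>

lemma mtotally_bounded_if_finite_codes:
  fixes code :: "real \<Rightarrow> 'a \<Rightarrow> 'b"
  assumes "S \<subseteq> M"
    and "\<And>e. e > 0 \<Longrightarrow> finite (code e ` S)"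
    and "\<And>e x y. e > 0 \<Longrightarrow> x \<in> S \<Longrightarrow> y \<in> S \<Longrightarrow> code e x = code e y \<Longrightarrow> d x y < e"
  shows "mtotally_bounded S"
  unfolding mtotally_bounded_def
proof (intro allI impI)
  fix e :: real assume e: "e > 0"
  let ?K = "inv_into S (code e) ` code e ` S"
  have "S \<subseteq> (\<Union>x\<in>?K. mball x e)"
  proof
    fix y assume y: "y \<in> S"
    let ?x = "inv_into S (code e) (code e y)"
    have "?x \<in> S" "code e ?x = code e y"
      using y by (auto intro: inv_into_into f_inv_into_f)
    then have "y \<in> mball ?x e" using assms(1) assms(3)[OF e _ y, of ?x] y by auto
    then show "y \<in> (\<Union>x\<in>?K. mball x e)" using y by blast
  qed
  moreover have "?K \<subseteq> S" by (auto intro: inv_into_into)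
  ultimately show "\<exists>K. finite K \<and> K \<subseteq> S \<and> S \<subseteq> (\<Union>x\<in>K. mball x e)"
    using assms(2)[OF e] by (meson finite_imageI)
qed

end

lemma compact_closure_iff_convergent_subsequences:
  fixes S :: "'a::metric_space set"
  shows "compact (closure S) \<longleftrightarrow>
    (\<forall>\<sigma>::nat \<Rightarrow> 'a. range \<sigma> \<subseteq> S \<longrightarrow> (\<exists>l r. strict_mono r \<and> (\<sigma> \<circ> r) \<longlonglongrightarrow> l))"
  using Met_TC.relatively_compact_iff_convergent_subsequences[of S]
  by simp

section \<open>The endograph metric in terms of near points\<close>

text \<open>Only points above height \<open>e\<close> have to be matched: the lower ones are within \<open>e\<close> of the
  bottom level \<open>X \<times> {0}\<close>, which all endographs share.\<close>

lemma H_end_le_if_near_points: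
  assumes f: "u \<in> fuzzy_sets" "v \<in> fuzzy_sets" and e: "0 \<le> e"
    and uv: "\<And>x t. e < t \<Longrightarrow> t \<le> u x \<Longrightarrow> \<exists>y s. 0 \<le> s \<and> s \<le> v y \<and> dist x y + \<bar>t - s\<bar> \<le> e"
    and vu: "\<And>x t. e < t \<Longrightarrow> t \<le> v x \<Longrightarrow> \<exists>y s. 0 \<le> s \<and> s \<le> u y \<and> dist x y + \<bar>t - s\<bar> \<le> e"
  shows "H_end u v \<le> e"
proof -
  have half: "(SUP a\<in>endograph u. INF b\<in>endograph v. ennreal (sum_dist a b)) \<le> ennreal e"
    if f: "v \<in> fuzzy_sets"
      and uv: "\<And>x t. e < t \<Longrightarrow> t \<le> u x \<Longrightarrow> \<exists>y s. 0 \<le> s \<and> s \<le> v y \<and> dist x y + \<bar>t - s\<bar> \<le> e"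
    for u v :: "'a \<Rightarrow> real"
  proof (rule SUP_least)
    fix a assume "a \<in> endograph u"
    then obtain x t where a: "a = (x, t)" "0 \<le> t" "t \<le> 1" "t \<le> u x"
      by (auto simp: endograph_def)
    have v: "0 \<le> v y" "v y \<le> 1" for y using f by (auto simp: fuzzy_sets_def)
    have "\<exists>y s. 0 \<le> s \<and> s \<le> v y \<and> dist x y + \<bar>t - s\<bar> \<le> e"
    proof (cases "e < t")
      case True
      then show ?thesis using uv a by blast
    next
      case False
      then show ?thesis using v a by (intro exI[of _ x] exI[of _ 0]) auto
    qed
    then obtain y s where ys: "0 \<le> s" "s \<le> v y" "dist x y + \<bar>t - s\<bar> \<le> e" by blast
    then have "(y, s) \<in> endograph v" using v[of y] by (auto simp: endograph_def)
    then have "(INF b\<in>endograph v. ennreal (sum_dist a b)) \<le> ennreal (sum_dist a (y, s))"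
      by (rule INF_lower)
    also have "\<dots> \<le> ennreal e" using ys a by (intro ennreal_leI) (simp add: sum_dist_def)
    finally show "(INF b\<in>endograph v. ennreal (sum_dist a b)) \<le> ennreal e" .
  qed
  have "Hausdorff (endograph u) (endograph v) \<le> ennreal e"
    using half[OF f(2) uv] half[OF f(1) vu] by (simp add: Hausdorff_def sum_dist_commute)
  then show ?thesis
    unfolding H_end_def using e enn2real_mono[of _ "ennreal e"] by simp
qed

text \<open>The converse passage, with strict inequality because the infimum defining the Hausdorff
  distance need not be attained.\<close>

lemma near_point_if_H_end_less:
  assumes f: "u \<in> fuzzy_sets" "v \<in> fuzzy_sets"
    and less: "H_end u v < e" and t: "0 \<le> t" "t \<le> u x"
  obtains y s where "0 \<le> s" "s \<le> v y" "dist x y + \<bar>t - s\<bar> < e"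
proof -
  have "Hausdorff (endograph u) (endograph v) = ennreal (H_end u v)"
    using Hausdorff_endograph_le_1[OF f]
    by (auto simp: H_end_def top_unique intro!: ennreal_enn2real[symmetric] intro: le_less_trans)
  also have "\<dots> < ennreal e" using less by (simp add: H_end_def ennreal_less_iff)
  finally have "(SUP a\<in>endograph u. INF b\<in>endograph v. ennreal (sum_dist a b)) < ennreal e"
    by (auto simp: Hausdorff_def)
  moreover have "(x, t) \<in> endograph u"
    using f t order_trans[of t "u x" 1] by (auto simp: endograph_def fuzzy_sets_def)
  ultimately have "(INF b\<in>endograph v. ennreal (sum_dist (x, t) b)) < ennreal e"
    by (meson SUP_upper le_less_trans)
  then obtain b where b: "b \<in> endograph v" "ennreal (sum_dist (x, t) b) < ennreal e"
    by (auto simp: INF_less_iff)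
  have "sum_dist (x, t) b < e"
    using b(2) by (subst (asm) ennreal_less_iff) (auto simp: sum_dist_def)
  then show thesis
    using b(1) that[of "snd b" "fst b"] by (auto simp: endograph_def sum_dist_def)
qed

lemma F_USCG_fuzzy_sets: "u \<in> F_USCG \<Longrightarrow> u \<in> fuzzy_sets"
  by (simp add: F_USCG_def F_USC_def)

text \<open>Positive cuts are closed as soon as they are compact, and the cut at level 0 is a closure,
  so compactness of the positive cuts is the only condition beyond the range \<open>[0, 1]\<close>.\<close>

lemma mem_F_USCG_iff:
  "u \<in> F_USCG \<longleftrightarrow> u \<in> fuzzy_sets \<and> (\<forall>\<alpha>\<in>{0<..1}. compact {x. \<alpha> \<le> u x})"
proof -
  have "alpha_cut u 0 \<in> nonempty_closed_sets \<union> {{}}"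
    by (auto simp: alpha_cut_def nonempty_closed_sets_def)
  then show ?thesis
    by (auto simp: F_USCG_def F_USC_def alpha_cut_def nonempty_closed_sets_def
        nonempty_compact_sets_def compact_imp_closed)
qed

lemma level_union_pos: "0 < \<alpha> \<Longrightarrow> level_union U \<alpha> = {x. \<exists>u\<in>U. \<alpha> \<le> u x}"
  by (auto simp: level_union_def alpha_cut_def)

section \<open>Cuts of a relatively compact family\<close>

text \<open>The points \<open>x n\<close> are compared with points \<open>y n\<close> of the limit's cut at the lower level
  \<open>\<alpha> / 2\<close>. Lowering the level is essential: points of the endograph of \<open>u\<close> near \<open>(x n, \<alpha>)\<close> may
  all lie slightly below height \<open>\<alpha>\<close>.\<close>

lemma convergent_subsequence_in_level:
  fixes \<sigma> :: "nat \<Rightarrow> 'a::metric_space \<Rightarrow> real"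
  assumes \<sigma>: "range \<sigma> \<subseteq> F_USCG"
    and lim: "limitin (Metric_space.mtopology F_USCG H_end) \<sigma> u sequentially"
    and \<alpha>: "0 < \<alpha>" "\<alpha> \<le> 1" and x: "\<And>n. \<alpha> \<le> \<sigma> n (x n)"
  shows "\<exists>l r. strict_mono r \<and> (x \<circ> r) \<longlonglongrightarrow> l"
proof -
  interpret Metric_space F_USCG H_end by (rule Metric_space_F_USCG)
  have u: "u \<in> F_USCG" and null: "(\<lambda>n. H_end (\<sigma> n) u) \<longlonglongrightarrow> 0"
    using lim by (auto simp: limitin_metric_dist_null)
  \<comment> \<open>The term \<open>1 / Suc n\<close> makes room for a strict inequality when the distance is 0.\<close>
  have "\<exists>y s. 0 \<le> s \<and> s \<le> u y \<and> dist (x n) y + \<bar>\<alpha> - s\<bar> < H_end (\<sigma> n) u + 1 / Suc n" for n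
  proof -
    have "\<sigma> n \<in> fuzzy_sets" "u \<in> fuzzy_sets" using \<sigma> u F_USCG_fuzzy_sets by blast+
    then show ?thesis
      using near_point_if_H_end_less[of "\<sigma> n" u "H_end (\<sigma> n) u + 1 / Suc n" \<alpha> "x n"] \<alpha> x[of n]
      by (metis add.commute divide_pos_pos less_add_same_cancel2 less_imp_le of_nat_0_less_iff
          zero_less_Suc zero_less_one)
  qed
  then obtain y s where
    ys: "\<And>n. s n \<le> u (y n)" "\<And>n. dist (x n) (y n) + \<bar>\<alpha> - s n\<bar> < H_end (\<sigma> n) u + 1 / Suc n"
    by metis
  have null2: "(\<lambda>n. H_end (\<sigma> n) u + 1 / Suc n) \<longlonglongrightarrow> 0"
    using tendsto_add[OF null LIMSEQ_inverse_real_of_nat] by (simp add: inverse_eq_divide)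
  then obtain N where N: "\<And>n. n \<ge> N \<Longrightarrow> H_end (\<sigma> n) u + 1 / Suc n < \<alpha> / 2"
    using order_tendstoD(2)[OF null2, of "\<alpha> / 2"] \<alpha> by (auto simp: eventually_sequentially)
  have "y (n + N) \<in> {z. \<alpha> / 2 \<le> u z}" for n
  proof -
    have "dist (x (n + N)) (y (n + N)) + \<bar>\<alpha> - s (n + N)\<bar> < \<alpha> / 2"
      using ys(2)[of "n + N"] N[of "n + N"] by linarith
    then have "\<alpha> / 2 \<le> s (n + N)" using zero_le_dist[of "x (n + N)" "y (n + N)"] by linarith
    then show ?thesis using ys(1)[of "n + N"] by simp
  qed
  moreover have "seq_compact {z. \<alpha> / 2 \<le> u z}"
  proof (rule compact_imp_seq_compact)
    have "\<alpha> / 2 \<in> {0<..1}" using \<alpha> by simp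
    then show "compact {z. \<alpha> / 2 \<le> u z}" using u unfolding mem_F_USCG_iff by blast
  qed
  ultimately obtain l r where lr: "strict_mono r" "((\<lambda>n. y (n + N)) \<circ> r) \<longlonglongrightarrow> l"
    unfolding seq_compact_def by metis
  define q where "q n = r n + N" for n
  have q: "strict_mono q" using lr(1) by (auto simp: q_def strict_mono_def)
  have "(\<lambda>n. dist (x n) (y n)) \<longlonglongrightarrow> 0"
  proof (rule tendsto_sandwich[OF _ _ tendsto_const null2])
    show "\<forall>\<^sub>F n in sequentially. dist (x n) (y n) \<le> H_end (\<sigma> n) u + 1 / Suc n"
      using ys(2) by (intro always_eventually allI) (smt (verit))
  qed auto
  from LIMSEQ_subseq_LIMSEQ[OF this q]
  have xy: "(\<lambda>n. dist (x (q n)) (y (q n))) \<longlonglongrightarrow> 0" by (simp add: comp_def)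
  have "(\<lambda>n. y (q n)) \<longlonglongrightarrow> l" using lr(2) by (simp add: q_def comp_def)
  then have "(\<lambda>n. dist (y (q n)) l) \<longlonglongrightarrow> 0" by (simp add: tendsto_dist_iff[of "\<lambda>n. y (q n)"])
  from tendsto_add[OF xy this]
  have "(\<lambda>n. dist (x (q n)) (y (q n)) + dist (y (q n)) l) \<longlonglongrightarrow> 0" by simp
  from tendsto_sandwich[OF _ _ tendsto_const this, of "\<lambda>n. dist (x (q n)) l"]
  have "(\<lambda>n. dist (x (q n)) l) \<longlonglongrightarrow> 0" by (simp add: dist_triangle)
  then have "(x \<circ> q) \<longlonglongrightarrow> l" by (simp add: tendsto_dist_iff[of "x \<circ> q"])
  then show ?thesis using q by blast
qed

section \<open>Total boundedness from relatively compact cuts\<close>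

text \<open>The endograph rounded to the grid \<open>F \<times> e\<nat>\<close>, with points of \<open>X\<close> moved by less than \<open>e\<close>
  and heights rounded down.\<close>

definition grid_code :: "'a::metric_space set \<Rightarrow> real \<Rightarrow> ('a \<Rightarrow> real) \<Rightarrow> ('a \<times> nat) set" where
  "grid_code F e u = {(z, j). z \<in> F \<and> (\<exists>y\<in>ball z e. real j * e \<le> u y)}"

lemma finite_range_grid_code:
  assumes "finite F" "0 < e" "U \<subseteq> fuzzy_sets"
  shows "finite (grid_code F e ` U)"
proof (rule finite_subset)
  have "j \<le> nat \<lceil>1 / e\<rceil>" if "real j * e \<le> u y" "u \<in> U" for j u y
  proof -
    have "u y \<le> 1" using that assms by (auto simp: fuzzy_sets_def)
    then have "real j * e \<le> 1" using that by linarith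
    then have "real j \<le> 1 / e" using assms by (simp add: field_simps)
    then show ?thesis by linarith
  qed
  then show "grid_code F e ` U \<subseteq> Pow (F \<times> {..nat \<lceil>1 / e\<rceil>})"
    by (auto simp: grid_code_def)
  show "finite (Pow (F \<times> {..nat \<lceil>1 / e\<rceil>}))" using assms by simp
qed

text \<open>A point \<open>(x, t)\<close> of the endograph of \<open>u\<close> is rounded to a grid point and from there led back
  to the endograph of \<open>v\<close>. Each of the two moves in \<open>X\<close> and the rounding of the height costs at
  most \<open>e\<close>, hence the factor 3.\<close>

lemma near_point_if_grid_code_subset:
  assumes e: "0 < e" and cover: "{x. e \<le> u x} \<subseteq> (\<Union>z\<in>F. ball z e)"
    and sub: "grid_code F e u \<subseteq> grid_code F e v"
    and t: "e < t" "t \<le> u x"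
  shows "\<exists>y s. 0 \<le> s \<and> s \<le> v y \<and> dist x y + \<bar>t - s\<bar> \<le> 3 * e"
proof -
  define j where "j = nat \<lfloor>t / e\<rfloor>"
  have "1 \<le> t / e" using e t by simp
  then have j: "0 < j" "real j \<le> t / e" "t / e < real j + 1" unfolding j_def by linarith+
  then have je: "real j * e \<le> t" "t < real j * e + e" using e by (auto simp: field_simps)
  obtain z where z: "z \<in> F" "x \<in> ball z e" using cover t by force
  then have "(z, j) \<in> grid_code F e u"
    using je j t by (auto simp: grid_code_def intro!: bexI[of _ x])
  then have "(z, j) \<in> grid_code F e v" using sub by blast
  then obtain y where y: "dist z y < e" "real j * e \<le> v y" by (auto simp: grid_code_def)
  have "dist x y \<le> dist z x + dist z y" by (rule dist_triangle3)
  then show ?thesis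
    using y z je e by (intro exI[of _ y] exI[of _ "real j * e"]) auto
qed

lemma mtotally_bounded_if_level_unions_relatively_compact:
  fixes U :: "('a::metric_space \<Rightarrow> real) set"
  assumes U: "U \<subseteq> F_USCG"
    and cpt: "\<And>\<alpha>. 0 < \<alpha> \<Longrightarrow> \<alpha> \<le> 1 \<Longrightarrow> compact (closure (level_union U \<alpha>))"
  shows "Metric_space.mtotally_bounded F_USCG H_end U"
proof -
  interpret Metric_space F_USCG H_end by (rule Metric_space_F_USCG)
  have fuzzy: "U \<subseteq> fuzzy_sets" using U F_USCG_fuzzy_sets by blast
  have "\<exists>F. finite F \<and> level_union U \<epsilon> \<subseteq> (\<Union>z\<in>F. ball z \<epsilon>)" if \<epsilon>: "0 < \<epsilon>" "\<epsilon> \<le> 1" for \<epsilon> :: real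
  proof -
    obtain F where "finite F" "closure (level_union U \<epsilon>) \<subseteq> (\<Union>z\<in>F. ball z \<epsilon>)"
      using compact_eq_totally_bounded[of "closure (level_union U \<epsilon>)"] cpt \<epsilon> by blast
    then show ?thesis using closure_subset by blast
  qed
  then obtain F where F: "\<And>\<epsilon>::real. 0 < \<epsilon> \<Longrightarrow> \<epsilon> \<le> 1 \<Longrightarrow> finite (F \<epsilon>)"
    "\<And>\<epsilon>::real. 0 < \<epsilon> \<Longrightarrow> \<epsilon> \<le> 1 \<Longrightarrow> level_union U \<epsilon> \<subseteq> (\<Union>z\<in>F \<epsilon>. ball z \<epsilon>)"
    by metis
  \<comment> \<open>The mesh: equal codes give distance at most \<open>3 * m e\<close>, which has to be below \<open>e\<close>, and the
    hypothesis on level unions speaks of levels up to 1 only.\<close>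
  define m where "m e = min (e / 4) 1" for e :: real
  have m: "0 < m e" "m e \<le> 1" "3 * m e < e" if "0 < e" for e using that by (auto simp: m_def)
  show ?thesis
  proof (rule mtotally_bounded_if_finite_codes[where code = "\<lambda>e. grid_code (F (m e)) (m e)", OF U])
    fix e :: real assume e: "0 < e"
    show "finite (grid_code (F (m e)) (m e) ` U)"
      using F m[OF e] fuzzy by (intro finite_range_grid_code) auto
    fix u v assume uv: "u \<in> U" "v \<in> U" "grid_code (F (m e)) (m e) u = grid_code (F (m e)) (m e) v"
    have cover: "{x. m e \<le> w x} \<subseteq> (\<Union>z\<in>F (m e). ball z (m e))" if "w \<in> U" for w
      using F(2)[of "m e"] m[OF e] that by (force simp: level_union_pos)
    have "H_end u v \<le> 3 * m e"
      using m[OF e] uv fuzzy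
        near_point_if_grid_code_subset[OF m(1)[OF e] cover, of u v]
        near_point_if_grid_code_subset[OF m(1)[OF e] cover, of v u]
      by (intro H_end_le_if_near_points) auto
    then show "H_end u v < e" using m[OF e] by linarith
  qed
qed

section \<open>Limits of Cauchy sequences\<close>

text \<open>A point \<open>(x, t)\<close> is a cluster point of the endographs of the sequence iff all heights in
  \<open>[0, t)\<close> are upper levels at \<open>x\<close>. Taking the supremum of the upper levels therefore gives the
  function whose endograph is the Kuratowski upper limit of the endographs.\<close>

definition upper_level :: "(nat \<Rightarrow> 'a::metric_space \<Rightarrow> real) \<Rightarrow> 'a \<Rightarrow> real \<Rightarrow> bool" where
  "upper_level \<sigma> x t \<longleftrightarrow> (\<forall>r>0. \<exists>\<^sub>F n in sequentially. \<exists>y\<in>ball x r. t \<le> \<sigma> n y)"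

definition upper_limit :: "(nat \<Rightarrow> 'a::metric_space \<Rightarrow> real) \<Rightarrow> 'a \<Rightarrow> real" where
  "upper_limit \<sigma> x = Sup {t \<in> {0..1}. upper_level \<sigma> x t}"

lemma upper_level_0: "range \<sigma> \<subseteq> fuzzy_sets \<Longrightarrow> upper_level \<sigma> x 0"
  unfolding upper_level_def fuzzy_sets_def
  by (intro allI impI eventually_frequently always_eventually bexI[of _ x]) auto

lemma upper_level_antimono:
  assumes "upper_level \<sigma> x t" "s \<le> t"
  shows "upper_level \<sigma> x s"
  unfolding upper_level_def
proof (intro allI impI)
  fix r :: real assume "0 < r"
  then have "\<exists>\<^sub>F n in sequentially. \<exists>y\<in>ball x r. t \<le> \<sigma> n y"
    using assms(1) unfolding upper_level_def by blast
  then show "\<exists>\<^sub>F n in sequentially. \<exists>y\<in>ball x r. s \<le> \<sigma> n y"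
    by (rule frequently_elim1) (use assms(2) order_trans in blast)
qed

lemma upper_limit_fuzzy_sets:
  assumes "range \<sigma> \<subseteq> fuzzy_sets"
  shows "upper_limit \<sigma> \<in> fuzzy_sets"
proof -
  have "0 \<le> upper_limit \<sigma> x" "upper_limit \<sigma> x \<le> 1" for x
    unfolding upper_limit_def using upper_level_0[OF assms, of x]
    by (auto intro!: cSup_upper cSup_least bdd_aboveI[of _ 1])
  then show ?thesis by (simp add: fuzzy_sets_def)
qed

lemma upper_limit_ge:
  assumes "upper_level \<sigma> x t" "0 \<le> t" "t \<le> 1"
  shows "t \<le> upper_limit \<sigma> x"
  unfolding upper_limit_def using assms by (auto intro!: cSup_upper bdd_aboveI[of _ 1])

lemma upper_level_if_less:
  assumes "range \<sigma> \<subseteq> fuzzy_sets" "t < upper_limit \<sigma> x"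
  shows "upper_level \<sigma> x t"
proof -
  have "\<exists>s\<in>{t \<in> {0..1}. upper_level \<sigma> x t}. t < s"
    using assms upper_level_0[OF assms(1), of x] unfolding upper_limit_def
    by (intro less_cSupD) (auto intro!: exI[of _ 0])
  then show ?thesis using upper_level_antimono by fastforce
qed

text \<open>A ball around a limit point of the cut contains a smaller ball around a point of the cut,
  so every level below \<open>\<alpha>\<close> is an upper level at the limit point too.\<close>

lemma closed_upper_limit_cut:
  assumes \<sigma>: "range \<sigma> \<subseteq> fuzzy_sets" and \<alpha>: "0 < \<alpha>" "\<alpha> \<le> 1"
  shows "closed {x. \<alpha> \<le> upper_limit \<sigma> x}"
proof -
  have "\<alpha> \<le> upper_limit \<sigma> x" if x: "x \<in> closure {x. \<alpha> \<le> upper_limit \<sigma> x}" for x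
  proof (rule dense_le_bounded[of 0 \<alpha>])
    show "0 < \<alpha>" by fact
    fix t assume t: "0 < t" "t < \<alpha>"
    have "upper_level \<sigma> x t"
      unfolding upper_level_def
    proof (intro allI impI)
      fix r :: real assume "0 < r"
      then obtain z where z: "\<alpha> \<le> upper_limit \<sigma> z" "dist z x < r / 2"
        using x by (metis closure_approachable half_gt_zero mem_Collect_eq)
      then have "upper_level \<sigma> z t" using upper_level_if_less[OF \<sigma>] t by fastforce
      then have "\<exists>\<^sub>F n in sequentially. \<exists>y\<in>ball z (r / 2). t \<le> \<sigma> n y"
        using \<open>0 < r\<close> by (simp add: upper_level_def)
      moreover have "ball z (r / 2) \<subseteq> ball x r"
        using z(2) by (auto simp: subset_eq dist_commute intro: dist_triangle_half_r)
      ultimately show "\<exists>\<^sub>F n in sequentially. \<exists>y\<in>ball x r. t \<le> \<sigma> n y"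
        by (elim frequently_elim1) blast
    qed
    then show "t \<le> upper_limit \<sigma> x" using t \<alpha> by (intro upper_limit_ge) auto
  qed
  then have "closure {x. \<alpha> \<le> upper_limit \<sigma> x} \<subseteq> {x. \<alpha> \<le> upper_limit \<sigma> x}" by blast
  then show ?thesis by (simp add: closure_subset_eq)
qed

lemma upper_limit_cut_subset:
  assumes \<sigma>: "range \<sigma> \<subseteq> fuzzy_sets" and \<beta>: "0 < \<beta>" "\<beta> < \<alpha>"
  shows "{x. \<alpha> \<le> upper_limit \<sigma> x} \<subseteq> closure (level_union (range \<sigma>) \<beta>)"
proof
  fix x assume "x \<in> {x. \<alpha> \<le> upper_limit \<sigma> x}"
  then have lev: "upper_level \<sigma> x \<beta>" using upper_level_if_less[OF \<sigma>] \<beta> by fastforce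
  show "x \<in> closure (level_union (range \<sigma>) \<beta>)"
    unfolding closure_approachable
  proof (intro allI impI)
    fix r :: real assume "0 < r"
    then obtain n y where "y \<in> ball x r" "\<beta> \<le> \<sigma> n y"
      using lev by (auto simp: upper_level_def dest!: frequently_ex)
    then show "\<exists>y\<in>level_union (range \<sigma>) \<beta>. dist y x < r"
      using \<beta> by (auto simp: level_union_pos dist_commute)
  qed
qed

lemma upper_limit_F_USCG:
  assumes \<sigma>: "range \<sigma> \<subseteq> F_USCG"
    and cpt: "\<And>\<alpha>. 0 < \<alpha> \<Longrightarrow> \<alpha> \<le> 1 \<Longrightarrow> compact (closure (level_union (range \<sigma>) \<alpha>))"
  shows "upper_limit \<sigma> \<in> F_USCG"
  unfolding mem_F_USCG_iff
proof (intro conjI ballI)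
  have f: "range \<sigma> \<subseteq> fuzzy_sets" using \<sigma> F_USCG_fuzzy_sets by blast
  then show "upper_limit \<sigma> \<in> fuzzy_sets" by (rule upper_limit_fuzzy_sets)
  fix \<alpha> :: real assume \<alpha>: "\<alpha> \<in> {0<..1}"
  have "compact (closure (level_union (range \<sigma>) (\<alpha> / 2)))" using \<alpha> by (intro cpt) auto
  moreover have "{x. \<alpha> \<le> upper_limit \<sigma> x} \<subseteq> closure (level_union (range \<sigma>) (\<alpha> / 2))"
    using \<alpha> by (intro upper_limit_cut_subset[OF f]) auto
  moreover have "closed {x. \<alpha> \<le> upper_limit \<sigma> x}"
    using \<alpha> by (intro closed_upper_limit_cut[OF f]) auto
  ultimately show "compact {x. \<alpha> \<le> upper_limit \<sigma> x}"
    by (metis compact_Int_closed inf.absorb2)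
qed

text \<open>Both endographs have to be matched. A point of height \<open>t\<close> over \<open>\<sigma> n\<close> has, by the Cauchy
  property, near points over all later terms; these lie over the relatively compact union of the
  \<open>(t - e)\<close>-cuts, so they cluster, and a cluster point carries an upper level. A point over the upper
  limit is, by definition, near to points over infinitely many terms, and these are near to
  points over \<open>\<sigma> n\<close> by the Cauchy property.\<close>

lemma MCauchy_limitin_upper_limit:
  fixes \<sigma> :: "nat \<Rightarrow> 'a::metric_space \<Rightarrow> real"
  assumes cauchy: "Metric_space.MCauchy F_USCG H_end \<sigma>"
    and cpt: "\<And>\<alpha>. 0 < \<alpha> \<Longrightarrow> \<alpha> \<le> 1 \<Longrightarrow> compact (closure (level_union (range \<sigma>) \<alpha>))"
  shows "limitin (Metric_space.mtopology F_USCG H_end) \<sigma> (upper_limit \<sigma>) sequentially"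
proof -
  interpret Metric_space F_USCG H_end by (rule Metric_space_F_USCG)
  let ?u = "upper_limit \<sigma>"
  have \<sigma>: "range \<sigma> \<subseteq> F_USCG" using cauchy by (simp add: MCauchy_def)
  then have f: "range \<sigma> \<subseteq> fuzzy_sets" using F_USCG_fuzzy_sets by blast
  then have fn: "\<sigma> n \<in> fuzzy_sets" for n by blast
  have u: "?u \<in> F_USCG" by (rule upper_limit_F_USCG[OF \<sigma> cpt])
  have near: "\<exists>N. \<forall>n\<ge>N. H_end (\<sigma> n) ?u \<le> 3 * e" if e: "0 < e" for e
  proof -
    obtain N where N: "\<And>n m. N \<le> n \<Longrightarrow> N \<le> m \<Longrightarrow> H_end (\<sigma> n) (\<sigma> m) < e"
      using cauchy e unfolding MCauchy_def by meson
    have "H_end (\<sigma> n) ?u \<le> 3 * e" if n: "N \<le> n" for n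
    proof (rule H_end_le_if_near_points[OF fn F_USCG_fuzzy_sets[OF u]])
      show "0 \<le> 3 * e" using e by simp
      fix x t assume t: "3 * e < t" "t \<le> \<sigma> n x"
      have t1: "t \<le> 1" using t(2) fn[of n] order_trans[of t "\<sigma> n x" 1] by (auto simp: fuzzy_sets_def)
      have "\<exists>y s. s \<le> \<sigma> (k + N) y \<and> dist x y + \<bar>t - s\<bar> < e" for k
      proof -
        have "0 \<le> t" "N \<le> k + N" using t e by simp_all
        then show ?thesis using t(2) by (meson near_point_if_H_end_less[OF fn fn N[OF n]])
      qed
      then obtain y s where ys: "\<And>k. s k \<le> \<sigma> (k + N) (y k)" "\<And>k. dist x (y k) + \<bar>t - s k\<bar> < e"
        by metis
      have dist: "dist x (y k) < e" and lev: "t - e \<le> \<sigma> (k + N) (y k)" for k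
        using ys(1)[of k] ys(2)[of k] zero_le_dist[of x "y k"] by linarith+
      have "range y \<subseteq> level_union (range \<sigma>) (t - e)"
        using lev t e by (auto simp: level_union_pos)
      moreover have "compact (closure (level_union (range \<sigma>) (t - e)))"
        using t t1 e by (intro cpt) auto
      ultimately obtain l r where lr: "strict_mono r" "(y \<circ> r) \<longlonglongrightarrow> l"
        unfolding compact_closure_iff_convergent_subsequences by meson
      have "dist x l \<le> e"
        using tendsto_dist[OF tendsto_const lr(2), of x] dist
        by (intro tendsto_upperbound[of "\<lambda>k. dist x ((y \<circ> r) k)"])
          (auto intro!: always_eventually less_imp_le)
      moreover have "upper_level \<sigma> l (t - e)"
        unfolding upper_level_def frequently_sequentially
      proof (intro allI impI)
        fix \<rho> :: real and m :: nat assume "0 < \<rho>"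
        then obtain K where K: "\<And>k. K \<le> k \<Longrightarrow> dist (y (r k)) l < \<rho>"
          using lr(2) by (auto simp: lim_sequentially)
        define k where "k = max K m"
        have "k \<le> r k" by (rule strict_mono_imp_increasing[OF lr(1)])
        then have "m \<le> r k + N" by (simp add: k_def)
        moreover have "y (r k) \<in> ball l \<rho>" using K[of k] by (simp add: k_def dist_commute)
        ultimately show "\<exists>j\<ge>m. \<exists>z\<in>ball l \<rho>. t - e \<le> \<sigma> j z" using lev[of "r k"] by blast
      qed
      then have "t - e \<le> ?u l" using t t1 e by (intro upper_limit_ge) auto
      ultimately show "\<exists>y s. 0 \<le> s \<and> s \<le> ?u y \<and> dist x y + \<bar>t - s\<bar> \<le> 3 * e"
        using t e by (intro exI[of _ l] exI[of _ "t - e"]) auto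
    next
      fix x t assume t: "3 * e < t" "t \<le> ?u x"
      have "upper_level \<sigma> x (t - e)" using upper_level_if_less[OF f] t e by fastforce
      then obtain m y where my: "N \<le> m" "dist x y < e" "t - e \<le> \<sigma> m y"
        using e by (force simp: upper_level_def frequently_sequentially)
      have "0 \<le> t - e" using t e by simp
      then obtain z s where zs: "0 \<le> s" "s \<le> \<sigma> n z" "dist y z + \<bar>(t - e) - s\<bar> < e"
        using my(3) by (meson near_point_if_H_end_less[OF fn fn N[OF my(1) n]])
      have "dist x z \<le> dist x y + dist y z" by (rule dist_triangle)
      then have "dist x z + \<bar>t - s\<bar> \<le> 3 * e" using zs(3) my(2) e by linarith
      then show "\<exists>y s. 0 \<le> s \<and> s \<le> \<sigma> n y \<and> dist x y + \<bar>t - s\<bar> \<le> 3 * e"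
        using zs by blast
    qed
    then show ?thesis by blast
  qed
  show ?thesis
    unfolding limitin_metric
  proof (intro conjI allI impI u)
    fix e :: real assume "0 < e"
    then obtain N where N: "\<forall>n\<ge>N. H_end (\<sigma> n) ?u \<le> 3 * (e / 4)" using near[of "e / 4"] by auto
    then have "\<forall>n\<ge>N. H_end (\<sigma> n) ?u < e" using \<open>0 < e\<close> by fastforce
    then show "\<forall>\<^sub>F n in sequentially. \<sigma> n \<in> F_USCG \<and> H_end (\<sigma> n) ?u < e"
      using \<sigma> unfolding eventually_sequentially by blast
  qed
qed

section \<open>The characterization\<close>

theorem theorem5p12:
  fixes U :: "('a::metric_space \<Rightarrow> real) set"
  assumes "U \<subseteq> F_USCG"
  shows "compactin (Metric_space.mtopology F_USCG H_end)
           ((Metric_space.mtopology F_USCG H_end) closure_of U)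
         \<longleftrightarrow> (\<forall>\<alpha>\<in>{0<..1}. compact (closure (level_union U \<alpha>)))"
proof -
  interpret Metric_space F_USCG H_end by (rule Metric_space_F_USCG)
  show ?thesis
    unfolding relatively_compact_iff_convergent_subsequences[OF assms]
  proof (intro iffI ballI allI impI)
    fix \<alpha> :: real assume \<alpha>: "\<alpha> \<in> {0<..1}"
    assume conv: "\<forall>\<sigma>::nat \<Rightarrow> 'a \<Rightarrow> real. range \<sigma> \<subseteq> U \<longrightarrow>
      (\<exists>l r. strict_mono r \<and> limitin mtopology (\<sigma> \<circ> r) l sequentially)"
    show "compact (closure (level_union U \<alpha>))"
      unfolding compact_closure_iff_convergent_subsequences
    proof (intro allI impI)
      fix x :: "nat \<Rightarrow> 'a" assume "range x \<subseteq> level_union U \<alpha>"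
      then have "\<forall>n. \<exists>u\<in>U. \<alpha> \<le> u (x n)" using \<alpha> by (auto simp: level_union_pos)
      then obtain \<sigma> where \<sigma>: "\<And>n. \<sigma> n \<in> U" "\<And>n. \<alpha> \<le> \<sigma> n (x n)" by metis
      then have "range \<sigma> \<subseteq> U" by blast
      then obtain u r where r: "strict_mono r" "limitin mtopology (\<sigma> \<circ> r) u sequentially"
        using conv by blast
      have "range (\<sigma> \<circ> r) \<subseteq> F_USCG" using \<sigma>(1) assms by auto
      then have "\<exists>l q. strict_mono q \<and> ((x \<circ> r) \<circ> q) \<longlonglongrightarrow> l"
        using convergent_subsequence_in_level[OF _ r(2), of \<alpha> "x \<circ> r"] \<sigma>(2) \<alpha> by simp
      then obtain l q where "strict_mono q" "(x \<circ> (r \<circ> q)) \<longlonglongrightarrow> l"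
        by (auto simp: comp_assoc)
      then show "\<exists>l r. strict_mono r \<and> (x \<circ> r) \<longlonglongrightarrow> l"
        using strict_mono_o[OF r(1)] by blast
    qed
  next
    assume cpt: "\<forall>\<alpha>\<in>{0<..1}. compact (closure (level_union U \<alpha>))"
    fix \<sigma> :: "nat \<Rightarrow> 'a \<Rightarrow> real" assume \<sigma>: "range \<sigma> \<subseteq> U"
    have "mtotally_bounded U"
      using assms cpt by (intro mtotally_bounded_if_level_unions_relatively_compact) auto
    then obtain r where r: "strict_mono r" "MCauchy (\<sigma> \<circ> r)"
      using \<sigma> unfolding mtotally_bounded_sequentially by blast
    have "compact (closure (level_union (range (\<sigma> \<circ> r)) \<alpha>))" if \<alpha>: "0 < \<alpha>" "\<alpha> \<le> 1" for \<alpha>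
    proof -
      have "level_union (range (\<sigma> \<circ> r)) \<alpha> \<subseteq> level_union U \<alpha>"
        using \<sigma> by (auto simp: level_union_def)
      then have "closure (level_union (range (\<sigma> \<circ> r)) \<alpha>) \<subseteq> closure (level_union U \<alpha>)"
        by (rule closure_mono)
      then show ?thesis
        using cpt \<alpha> by (metis closed_closure compact_Int_closed greaterThanAtMost_iff inf.absorb2)
    qed
    then have "limitin mtopology (\<sigma> \<circ> r) (upper_limit (\<sigma> \<circ> r)) sequentially"
      by (rule MCauchy_limitin_upper_limit[OF r(2)])
    then show "\<exists>l r. strict_mono r \<and> limitin mtopology (\<sigma> \<circ> r) l sequentially"
      using r(1) by blast
  qed
qed

end
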